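(* Let $d\ge2$, $m\ge1$ be integers and let $(A,B)\in P_{d,m}$ be a non-controllable pair such that $\mathrm{PLARC}(A,B)$ is nonempty. Then $B=0$, $d=2$ and the eigenvalues of $A$ are non-real.
   Context: $M_{d,m}(\mathbb{R})$ is the set of real $d\times m$ matrices, $M_d(\mathbb{R})=M_{d,d}(\mathbb{R})$, and $P_{d,m}=M_d(\mathbb{R})\times M_{d,m}(\mathbb{R})$. Controllability of $(A,B)$ is the usual (Kalman rank) controllability of $\dot x=Ax+Bu$. Let $\Pi:\mathbb{R}^d\setminus\{0\}\to\mathbb{RP}^{d-1}$ be the canonical projection. For $A\in M_d(\mathbb{R})$, $\Pi A$ is the vector field on $\mathbb{RP}^{d-1}$ given, for $q=\Pi x$, by $(\Pi A)(q)=d\Pi_x\big(Ax-\frac{\langle x,Ax\rangle}{|x|^2}x\big)$ (Euclidean norm and scalar product). $\mathrm{PLARC}(A,B)$ is the set of $K\in M_{m,d}(\mathbb{R})$ such that the Lie algebra of vector fields generated by $\Pi A$ and $\Pi(BK)$, evaluated at $q$, equals $T_q\mathbb{RP}^{d-1}$ for every $q\in\mathbb{RP}^{d-1}$. *)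

theory Defs
  imports "HOL-Analysis.Analysis"
begin

section \<open>Linear control systems\<close>

text \<open>A pair in $P_{d,m}$ consists of \<open>A :: real^'d^'d\<close> and \<open>B :: real^'m^'d\<close>, where
  \<open>d = CARD('d)\<close> and \<open>m = CARD('m)\<close>.\<close>

text \<open>The Kalman matrix $[B, AB, \ldots, A^{d-1}B]$ has rank \<open>d\<close>; its rank is the dimension of
  the span of the columns of its blocks.\<close>

definition controllable :: "real^'d^'d \<Rightarrow> real^'m^'d \<Rightarrow> bool" where
  "controllable A B \<longleftrightarrow>
     dim (\<Union>i<CARD('d). columns (((\<lambda>M. A ** M) ^^ i) B)) = CARD('d)"

definition complex_eigenvalue :: "real^'d^'d \<Rightarrow> complex \<Rightarrow> bool" where
  "complex_eigenvalue A z \<longleftrightarrow> (\<exists>v. v \<noteq> 0 \<and> map_matrix complex_of_real A *v v = z *s v)"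


section \<open>Smooth functions\<close>

text \<open>Meant for open \<open>S\<close> in a finite-dimensional space, where it is the usual class $C^k$:
  all iterated directional derivatives up to order \<open>k\<close> exist and are continuous.\<close>

fun Ck_on :: "nat \<Rightarrow> 'a::real_normed_vector set \<Rightarrow> ('a \<Rightarrow> real) \<Rightarrow> bool" where
  "Ck_on 0 S f \<longleftrightarrow> continuous_on S f"
| "Ck_on (Suc k) S f \<longleftrightarrow>
     (\<forall>x\<in>S. f differentiable (at x)) \<and>
     (\<forall>v. Ck_on k S (\<lambda>x. frechet_derivative f (at x) v))"

definition Cinf_on :: "'a::real_normed_vector set \<Rightarrow> ('a \<Rightarrow> real) \<Rightarrow> bool" where
  "Cinf_on S f \<longleftrightarrow> (\<forall>k. Ck_on k S f)"


section \<open>Real projective space\<close>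

definition collinear_rel :: "real^'d \<Rightarrow> real^'d \<Rightarrow> bool" where
  "collinear_rel x y \<longleftrightarrow> x \<noteq> 0 \<and> y \<noteq> 0 \<and> (\<exists>c. c \<noteq> 0 \<and> y = c *\<^sub>R x)"

lemma collinear_rel_part_equivp: "part_equivp (collinear_rel :: real^'d \<Rightarrow> real^'d \<Rightarrow> bool)"
proof (rule part_equivpI)
  have "collinear_rel (axis undefined 1 :: real^'d) (axis undefined 1)"
    unfolding collinear_rel_def by (auto simp: axis_eq_0_iff intro!: exI[of _ 1])
  then show "\<exists>x :: real^'d. collinear_rel x x" ..
  show "symp (collinear_rel :: real^'d \<Rightarrow> real^'d \<Rightarrow> bool)"
  proof (rule sympI)
    fix x y :: "real^'d"
    assume "collinear_rel x y"
    then obtain c where "x \<noteq> 0" "y \<noteq> 0" "c \<noteq> 0" "y = c *\<^sub>R x"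
      by (auto simp: collinear_rel_def)
    then have "inverse c \<noteq> 0" "x = inverse c *\<^sub>R y" by simp_all
    then show "collinear_rel y x"
      unfolding collinear_rel_def using \<open>x \<noteq> 0\<close> \<open>y \<noteq> 0\<close> by blast
  qed
  show "transp (collinear_rel :: real^'d \<Rightarrow> real^'d \<Rightarrow> bool)"
    by (rule transpI) (auto simp: collinear_rel_def)
qed

text \<open>\<open>'d rproj\<close> is $\mathbb{RP}^{d-1}$, the quotient of $\mathbb{R}^d \setminus \{0\}$.\<close>

quotient_type 'd rproj = "real^('d::finite)" / partial: collinear_rel
  by (rule collinear_rel_part_equivp)

text \<open>The canonical projection; its value at \<open>0\<close> is meaningless.\<close>

definition proj :: "real^'d \<Rightarrow> 'd::finite rproj" where
  "proj = abs_rproj"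

lemma proj_eq_iff:
  assumes "x \<noteq> 0" "y \<noteq> 0"
  shows "proj x = proj y \<longleftrightarrow> (\<exists>c. c \<noteq> 0 \<and> y = c *\<^sub>R x)"
proof -
  have "collinear_rel x x" "collinear_rel y y"
    using assms by (auto simp: collinear_rel_def intro!: exI[of _ 1])
  then show ?thesis
    using Quotient_rel[OF Quotient_rproj, of x y] assms
    by (auto simp: proj_def collinear_rel_def)
qed

lemma proj_surj: "\<exists>x. x \<noteq> 0 \<and> proj x = q"
proof -
  have "collinear_rel (rep_rproj q) (rep_rproj q)"
    using Quotient_rep_reflp[OF Quotient_rproj] .
  then have "rep_rproj q \<noteq> 0" by (simp add: collinear_rel_def)
  moreover have "proj (rep_rproj q) = q"
    unfolding proj_def using Quotient_abs_rep[OF Quotient_rproj] .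
  ultimately show ?thesis by blast
qed

text \<open>The smooth structure of $\mathbb{RP}^{d-1}$ is the one making \<open>proj\<close> a submersion, so a
  function is smooth iff its pullback to $\mathbb{R}^d \setminus \{0\}$ is.\<close>

definition smooth_rproj :: "('d::finite rproj \<Rightarrow> real) \<Rightarrow> bool" where
  "smooth_rproj f \<longleftrightarrow> Cinf_on (UNIV - {0}) (f \<circ> proj)"


section \<open>Tangent vectors and vector fields\<close>

text \<open>Tangent vectors at \<open>q\<close> are the derivations at \<open>q\<close> of the algebra of smooth functions. As HOL
  functions are total, they are extended by \<open>0\<close> to non-smooth functions. This normal form makes
  equality of tangent vectors coincide with equality on smooth functions.\<close>

definition tangent_space :: "'d::finite rproj \<Rightarrow> (('d rproj \<Rightarrow> real) \<Rightarrow> real) set" where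
  "tangent_space q = {D.
     (\<forall>f. \<not> smooth_rproj f \<longrightarrow> D f = 0) \<and>
     (\<forall>f g. smooth_rproj f \<longrightarrow> smooth_rproj g \<longrightarrow> D (\<lambda>p. f p + g p) = D f + D g) \<and>
     (\<forall>c f. smooth_rproj f \<longrightarrow> D (\<lambda>p. c * f p) = c * D f) \<and>
     (\<forall>f g. smooth_rproj f \<longrightarrow> smooth_rproj g \<longrightarrow>
        D (\<lambda>p. f p * g p) = f q * D g + g q * D f)}"

text \<open>\<open>dproj x v\<close> is $d\Pi_x(v)$, the tangent vector $f \mapsto d(f \circ \Pi)_x(v)$ at
  $\Pi x$.\<close>

definition dproj :: "real^'d \<Rightarrow> real^'d \<Rightarrow> ('d::finite rproj \<Rightarrow> real) \<Rightarrow> real" where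
  "dproj x v f = (if smooth_rproj f then frechet_derivative (f \<circ> proj) (at x) v else 0)"

type_synonym 'd vfield = "'d rproj \<Rightarrow> ('d rproj \<Rightarrow> real) \<Rightarrow> real"

text \<open>The vector field $\Pi A$, by means of an arbitrary representative of \<open>q\<close>; see
  \<open>proj_vfield_proj\<close> below for the independence of this choice.\<close>

definition proj_vfield :: "real^'d^'d \<Rightarrow> 'd::finite vfield" where
  "proj_vfield A q =
     (let x = (SOME x. x \<noteq> 0 \<and> proj x = q)
      in dproj x (A *v x - ((x \<bullet> (A *v x)) / (norm x)\<^sup>2) *\<^sub>R x))"

lemma dproj_scale:
  assumes x: "x \<noteq> 0" and c: "c \<noteq> 0"
  shows "dproj (c *\<^sub>R x) (c *\<^sub>R v) = dproj x v"
proof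
  fix f :: "'a rproj \<Rightarrow> real"
  show "dproj (c *\<^sub>R x) (c *\<^sub>R v) f = dproj x v f"
  proof (cases "smooth_rproj f")
    case True
    let ?g = "f \<circ> proj"
    let ?D = "frechet_derivative ?g (at (c *\<^sub>R x))"
    have "Ck_on (Suc 0) (UNIV - {0}) ?g"
      using True unfolding smooth_rproj_def Cinf_on_def by blast
    then have "?g differentiable (at (c *\<^sub>R x))"
      using x c by simp
    then have "(?g has_derivative ?D) (at (c *\<^sub>R x))"
      by (simp add: frechet_derivative_works)
    moreover have "((\<lambda>y. c *\<^sub>R y) has_derivative (\<lambda>y. c *\<^sub>R y)) (at x)"
      by (auto intro!: derivative_eq_intros)
    ultimately have "((\<lambda>y. ?g (c *\<^sub>R y)) has_derivative (\<lambda>y. ?D (c *\<^sub>R y))) (at x)"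
      using has_derivative_compose by blast
    then have "(?g has_derivative (\<lambda>y. ?D (c *\<^sub>R y))) (at x)"
    proof (rule has_derivative_transform_within_open[where s = "UNIV - {0}"])
      show "open (UNIV - {0 :: real^'a})" by auto
      show "x \<in> UNIV - {0}" using x by simp
      fix y :: "real^'a"
      assume "y \<in> UNIV - {0}"
      then have "proj (c *\<^sub>R y) = proj y"
        using c proj_eq_iff[of y "c *\<^sub>R y"] by auto
      then show "?g (c *\<^sub>R y) = ?g y" by simp
    qed
    then have "frechet_derivative ?g (at x) = (\<lambda>y. ?D (c *\<^sub>R y))"
      by (metis frechet_derivative_at)
    then show ?thesis using True by (simp add: dproj_def)
  qed (simp add: dproj_def)
qed

lemma proj_vfield_proj:
  assumes "x \<noteq> 0"
  shows "proj_vfield A (proj x) =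
           dproj x (A *v x - ((x \<bullet> (A *v x)) / (norm x)\<^sup>2) *\<^sub>R x)"
proof -
  define y where "y = (SOME y. y \<noteq> 0 \<and> proj y = proj x)"
  have y: "y \<noteq> 0 \<and> proj y = proj x"
    unfolding y_def by (rule someI[of _ x]) (use assms in simp)
  then obtain c where c: "c \<noteq> 0" "y = c *\<^sub>R x"
    using assms proj_eq_iff[of x y] by auto
  have "A *v y - ((y \<bullet> (A *v y)) / (norm y)\<^sup>2) *\<^sub>R y =
        c *\<^sub>R (A *v x - ((x \<bullet> (A *v x)) / (norm x)\<^sup>2) *\<^sub>R x)"
    using c by (simp add: matrix_vector_mult_scaleR scaleR_diff_right power_mult_distrib
        power2_eq_square[of c])
  then show ?thesis
    unfolding proj_vfield_def Let_def y_def[symmetric]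
    using dproj_scale[OF assms c(1)] c(2) by simp
qed

definition bracket :: "'d::finite vfield \<Rightarrow> 'd vfield \<Rightarrow> 'd vfield" where
  "bracket X Y q f = X q (\<lambda>p. Y p f) - Y q (\<lambda>p. X p f)"

inductive_set generated_lie_algebra :: "'d::finite vfield set \<Rightarrow> 'd vfield set"
  for \<X> :: "'d vfield set" where
  gen: "X \<in> \<X> \<Longrightarrow> X \<in> generated_lie_algebra \<X>"
| zero: "(\<lambda>q f. 0) \<in> generated_lie_algebra \<X>"
| add: "X \<in> generated_lie_algebra \<X> \<Longrightarrow> Y \<in> generated_lie_algebra \<X> \<Longrightarrow>
    (\<lambda>q f. X q f + Y q f) \<in> generated_lie_algebra \<X>"
| scale: "X \<in> generated_lie_algebra \<X> \<Longrightarrow> (\<lambda>q f. c * X q f) \<in> generated_lie_algebra \<X>"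
| bracket: "X \<in> generated_lie_algebra \<X> \<Longrightarrow> Y \<in> generated_lie_algebra \<X> \<Longrightarrow>
    bracket X Y \<in> generated_lie_algebra \<X>"

definition PLARC :: "real^'d^'d \<Rightarrow> real^'m^'d \<Rightarrow> (real^'d^'m) set" where
  "PLARC A B = {K. \<forall>q.
     {X q | X. X \<in> generated_lie_algebra {proj_vfield A, proj_vfield (B ** K)}} =
     tangent_space q}"

end

theory Submission
  imports Defs
begin

text \<open>If \<open>V\<close> is a nonzero proper subspace invariant under \<open>A\<close> and \<open>B K\<close>, then both projective vector
  fields, hence the Lie algebra they generate, are tangent to the projectivisation of \<open>V\<close>, so the
  rank condition fails on it. For a non-controllable pair, the Kalman filtration stabilises at a
  proper \<open>A\<close>-invariant subspace containing the image of \<open>B\<close>; it must be \<open>0\<close>, so \<open>B = 0\<close>. Then the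
  Lie algebra is spanned by one vector field, so the projective space has dimension 1, and the
  line through a real eigenvector of \<open>A\<close> would again be a forbidden subspace.\<close>

section \<open>Calculus of smooth functions\<close>

text \<open>Derivatives are taken in the whole space and \<open>f\<close>, \<open>g\<close> may
  differ outside \<open>S\<close>. Since \<open>S\<close> is open, they agree near each of its
  points, hence so do their derivatives there, and induction carries this to higher orders.\<close>

lemma Ck_on_cong:
  assumes "open S" "\<And>x. x \<in> S \<Longrightarrow> f x = g x" "Ck_on k S f"
  shows "Ck_on k S g"
  using assms(2,3)
proof (induction k arbitrary: f g)
  case 0
  then show ?case by (simp cong: continuous_on_cong)
next
  case (Suc k)
  have der: "(g has_derivative frechet_derivative f (at x)) (at x)" if "x \<in> S" for x
  proof (rule has_derivative_transform_within_open[OF _ assms(1) that])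
    show "(f has_derivative frechet_derivative f (at x)) (at x)"
      using Suc.prems(2) that by (simp add: frechet_derivative_works)
  qed (rule Suc.prems(1))
  have "frechet_derivative f (at x) = frechet_derivative g (at x)" if "x \<in> S" for x
    by (rule frechet_derivative_at[OF der[OF that]])
  then have "Ck_on k S (\<lambda>x. frechet_derivative g (at x) v)" for v
    using Suc.IH[of "\<lambda>x. frechet_derivative f (at x) v" "\<lambda>x. frechet_derivative g (at x) v"]
      Suc.prems(2) by simp
  then show ?case using der unfolding Ck_on.simps differentiable_def by blast
qed

text \<open>\<open>frechet_derivative\<close> is defined by choice; uniqueness of the derivative
  allows an explicit formula \<open>f'\<close> in its place, which is what the differentiation rules
  below supply.\<close>

lemma Ck_on_SucI:
  assumes "open S" "\<And>x. x \<in> S \<Longrightarrow> (f has_derivative f' x) (at x)"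
    "\<And>v. Ck_on k S (\<lambda>x. f' x v)"
  shows "Ck_on (Suc k) S f"
proof -
  have "f' x = frechet_derivative f (at x)" if "x \<in> S" for x
    using assms(2)[OF that] by (rule frechet_derivative_at)
  then have "Ck_on k S (\<lambda>x. frechet_derivative f (at x) v)" for v
    by (intro Ck_on_cong[OF assms(1) _ assms(3)[of v]]) (rule fun_cong)
  then show ?thesis using assms(2) unfolding Ck_on.simps differentiable_def by blast
qed

lemma Ck_on_Suc_imp: "Ck_on (Suc k) S f \<Longrightarrow> Ck_on k S f"
proof (induction k arbitrary: f)
  case 0
  then show ?case
    by (simp add: differentiable_imp_continuous_on differentiable_at_imp_differentiable_on)
next
  case (Suc k)
  show ?case
    unfolding Ck_on.simps(2)[of k] using Suc.IH Suc.prems Ck_on.simps(2)[of "Suc k"] by blast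
qed

lemma Ck_on_has_derivative:
  "Ck_on (Suc k) S f \<Longrightarrow> x \<in> S \<Longrightarrow> (f has_derivative frechet_derivative f (at x)) (at x)"
  by (simp add: frechet_derivative_works)

lemma Ck_on_frechet: "Ck_on (Suc k) S f \<Longrightarrow> Ck_on k S (\<lambda>x. frechet_derivative f (at x) v)"
  by simp

lemma Ck_on_const: "open S \<Longrightarrow> Ck_on k S (\<lambda>x. c)"
proof (induction k arbitrary: c)
  case (Suc k)
  show ?case by (rule Ck_on_SucI[where f' = "\<lambda>_ _. 0"]) (use Suc in auto)
qed simp

lemma Ck_on_bounded_linear:
  assumes "open S" "bounded_linear f"
  shows "Ck_on k S f"
proof (cases k)
  case 0
  then show ?thesis using assms by (simp add: linear_continuous_on)
next
  case (Suc n)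
  show ?thesis unfolding Suc
    by (rule Ck_on_SucI[where f' = "\<lambda>_. f"])
      (rule assms(1) bounded_linear_imp_has_derivative[OF assms(2)] Ck_on_const[OF assms(1)])+
qed

lemma Ck_on_add:
  assumes "open S" "Ck_on k S f" "Ck_on k S g"
  shows "Ck_on k S (\<lambda>x. f x + g x)"
  using assms(2,3)
proof (induction k arbitrary: f g)
  case 0
  then show ?case by (simp add: continuous_on_add)
next
  case (Suc k)
  show ?case
    by (rule Ck_on_SucI[where f' = "\<lambda>x v. frechet_derivative f (at x) v + frechet_derivative g (at x) v"])
      (rule assms(1) has_derivative_add Ck_on_has_derivative Suc.IH Ck_on_frechet Suc.prems | assumption)+
qed

lemma Ck_on_mult:
  assumes "open S" "Ck_on k S f" "Ck_on k S g"
  shows "Ck_on k S (\<lambda>x. f x * g x)"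
  using assms(2,3)
proof (induction k arbitrary: f g)
  case 0
  then show ?case by (simp add: continuous_on_mult)
next
  case (Suc k)
  \<comment> \<open>The product rule keeps \<open>f\<close> and \<open>g\<close> undifferentiated as
    factors, so they are needed at order \<open>k\<close> too.\<close>
  have "Ck_on k S f" "Ck_on k S g"
    using Suc.prems by (blast intro: Ck_on_Suc_imp)+
  then show ?case
    by (intro Ck_on_SucI[where f' = "\<lambda>x v. f x * frechet_derivative g (at x) v + frechet_derivative f (at x) v * g x"])
      (rule assms(1) has_derivative_mult Ck_on_has_derivative Ck_on_add Suc.IH Ck_on_frechet
        Suc.prems | assumption)+
qed

text \<open>The derivative -f'/f^2 is a product of f' and copies of 1/f, and 1/f is already of order
  \<open>k\<close> by induction.\<close>

lemma Ck_on_inverse: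
  assumes "open S" "Ck_on k S f" "\<And>x. x \<in> S \<Longrightarrow> f x \<noteq> 0"
  shows "Ck_on k S (\<lambda>x. inverse (f x))"
  using assms(2)
proof (induction k)
  case 0
  then show ?case using assms(3) by (simp add: continuous_on_inverse)
next
  case (Suc k)
  then have *: "Ck_on k S (\<lambda>x. inverse (f x))"
    by (blast intro: Ck_on_Suc_imp)
  show ?case
  proof (rule Ck_on_SucI[OF assms(1)])
    fix x assume "x \<in> S"
    then show "((\<lambda>x. inverse (f x)) has_derivative
        (\<lambda>v. (- 1) * (inverse (f x) * frechet_derivative f (at x) v * inverse (f x)))) (at x)"
      using Deriv.has_derivative_inverse[OF _ Ck_on_has_derivative[OF Suc.prems]] assms(3) by simp
  next
    fix v
    show "Ck_on k S (\<lambda>x. (- 1) * (inverse (f x) * frechet_derivative f (at x) v * inverse (f x)))"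
      using Suc.prems *
      by (intro Ck_on_mult Ck_on_const assms(1) Ck_on_frechet)
  qed
qed

section \<open>Closure properties of infinitely differentiable functions\<close>

lemma Cinf_on_const: "open S \<Longrightarrow> Cinf_on S (\<lambda>x. c)"
  by (simp add: Cinf_on_def Ck_on_const)

lemma Cinf_on_bounded_linear: "open S \<Longrightarrow> bounded_linear f \<Longrightarrow> Cinf_on S f"
  by (simp add: Cinf_on_def Ck_on_bounded_linear)

lemma Cinf_on_add:
  "open S \<Longrightarrow> Cinf_on S f \<Longrightarrow> Cinf_on S g \<Longrightarrow> Cinf_on S (\<lambda>x. f x + g x)"
  by (simp add: Cinf_on_def Ck_on_add)

lemma Cinf_on_mult:
  "open S \<Longrightarrow> Cinf_on S f \<Longrightarrow> Cinf_on S g \<Longrightarrow> Cinf_on S (\<lambda>x. f x * g x)"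
  by (simp add: Cinf_on_def Ck_on_mult)

lemma Cinf_on_inverse:
  "open S \<Longrightarrow> Cinf_on S f \<Longrightarrow> (\<And>x. x \<in> S \<Longrightarrow> f x \<noteq> 0) \<Longrightarrow> Cinf_on S (\<lambda>x. inverse (f x))"
  by (simp add: Cinf_on_def Ck_on_inverse)

lemma Cinf_on_cong:
  assumes "open S" "Cinf_on S f" "\<And>x. x \<in> S \<Longrightarrow> f x = g x"
  shows "Cinf_on S g"
  using assms(2) Ck_on_cong[OF assms(1,3)] unfolding Cinf_on_def by simp

lemma Cinf_on_divide:
  assumes "open S" "Cinf_on S f" "Cinf_on S g" "\<And>x. x \<in> S \<Longrightarrow> g x \<noteq> 0"
  shows "Cinf_on S (\<lambda>x. f x / g x)"
  unfolding divide_inverse by (intro Cinf_on_mult Cinf_on_inverse assms)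

lemma Cinf_on_diff:
  assumes "open S" "Cinf_on S f" "Cinf_on S g"
  shows "Cinf_on S (\<lambda>x. f x - g x)"
  using Cinf_on_add[OF assms(1,2) Cinf_on_mult[OF assms(1) Cinf_on_const[OF assms(1), of "- 1"] assms(3)]]
  by simp

lemma Cinf_on_sum:
  assumes "open S"
  shows "(\<And>i. i \<in> I \<Longrightarrow> Cinf_on S (f i)) \<Longrightarrow> Cinf_on S (\<lambda>x. \<Sum>i\<in>I. f i x)"
  by (induction I rule: infinite_finite_induct) (simp_all add: Cinf_on_const Cinf_on_add assms)

lemma Cinf_on_frechet: "Cinf_on S f \<Longrightarrow> Cinf_on S (\<lambda>x. frechet_derivative f (at x) v)"
  unfolding Cinf_on_def by (intro allI Ck_on_frechet) (rule spec)

lemma Cinf_on_has_derivative: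
  "Cinf_on S f \<Longrightarrow> x \<in> S \<Longrightarrow> (f has_derivative frechet_derivative f (at x)) (at x)"
  unfolding Cinf_on_def by (rule Ck_on_has_derivative[of 0]) (rule spec)

lemma Cinf_on_inner:
  fixes f g :: "'a::real_normed_vector \<Rightarrow> 'b::euclidean_space"
  assumes "open S" "\<And>b. b \<in> Basis \<Longrightarrow> Cinf_on S (\<lambda>x. f x \<bullet> b)"
    "\<And>b. b \<in> Basis \<Longrightarrow> Cinf_on S (\<lambda>x. g x \<bullet> b)"
  shows "Cinf_on S (\<lambda>x. f x \<bullet> g x)"
  by (subst euclidean_inner) (intro Cinf_on_sum Cinf_on_mult assms)

text \<open>The direction moves with the point, whereas \<open>Ck_on\<close> speaks of fixed
  directions only. Linearity of the derivative expands it over \<open>Basis\<close> into fixed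
  directions with smooth coefficients.\<close>

lemma Cinf_on_directional:
  fixes f :: "'a::euclidean_space \<Rightarrow> real" and w :: "'a \<Rightarrow> 'a"
  assumes "open S" "Cinf_on S f" "\<And>b. b \<in> Basis \<Longrightarrow> Cinf_on S (\<lambda>x. w x \<bullet> b)"
  shows "Cinf_on S (\<lambda>x. frechet_derivative f (at x) (w x))"
proof (rule Cinf_on_cong[OF assms(1)])
  show "Cinf_on S (\<lambda>x. \<Sum>b\<in>Basis. (w x \<bullet> b) * frechet_derivative f (at x) b)"
    by (intro Cinf_on_sum Cinf_on_mult Cinf_on_frechet assms)
  fix x assume "x \<in> S"
  then have "linear (frechet_derivative f (at x))"
    by (rule has_derivative_linear[OF Cinf_on_has_derivative[OF assms(2)]])
  \<comment> \<open>The index 1 is the basis vector of the real codomain, where the component along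
    1 is the value itself.\<close>
  from Linear_Algebra.linear_componentwise[OF this, of "w x" 1]
  show "(\<Sum>b\<in>Basis. (w x \<bullet> b) * frechet_derivative f (at x) b) =
      frechet_derivative f (at x) (w x)"
    by simp
qed

section \<open>Smooth functions and tangent vectors on projective space\<close>

lemma open_punctured: "open (UNIV - {0 :: real^'d})"
  by auto

lemma smooth_const: "smooth_rproj (\<lambda>p. c)"
  unfolding smooth_rproj_def o_def by (rule Cinf_on_const[OF open_punctured])

lemma smooth_add: "smooth_rproj f \<Longrightarrow> smooth_rproj g \<Longrightarrow> smooth_rproj (\<lambda>p. f p + g p)"
  unfolding smooth_rproj_def o_def by (rule Cinf_on_add[OF open_punctured])

lemma smooth_diff: "smooth_rproj f \<Longrightarrow> smooth_rproj g \<Longrightarrow> smooth_rproj (\<lambda>p. f p - g p)"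
  unfolding smooth_rproj_def o_def by (rule Cinf_on_diff[OF open_punctured])

lemma smooth_mult: "smooth_rproj f \<Longrightarrow> smooth_rproj g \<Longrightarrow> smooth_rproj (\<lambda>p. f p * g p)"
  unfolding smooth_rproj_def o_def by (rule Cinf_on_mult[OF open_punctured])

lemma smooth_scale: "smooth_rproj f \<Longrightarrow> smooth_rproj (\<lambda>p. c * f p)"
  by (intro smooth_mult smooth_const)

lemma smooth_has_derivative:
  assumes "smooth_rproj f" "x \<noteq> 0"
  shows "((\<lambda>y. f (proj y)) has_derivative (\<lambda>v. dproj x v f)) (at x)"
  using assms Cinf_on_has_derivative[of "UNIV - {0}" "f \<circ> proj" x]
  by (simp add: smooth_rproj_def dproj_def o_def)

lemma dproj_eqI:
  assumes "smooth_rproj f" "x \<noteq> 0" "((\<lambda>y. f (proj y)) has_derivative D) (at x)"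
  shows "dproj x v f = D v"
  by (rule fun_cong[OF has_derivative_unique[OF smooth_has_derivative[OF assms(1,2)] assms(3)]])

lemma dproj_not_smooth: "\<not> smooth_rproj f \<Longrightarrow> dproj x v f = 0"
  by (simp add: dproj_def)

text \<open>The sum and product rules for pullbacks are the derivation laws. Hence the rank
  condition forces every \<open>dproj x v\<close> to be a value of the Lie algebra, and the
  contradictions below exhibit one that is not.\<close>

lemma dproj_in_tangent_space:
  assumes x: "x \<noteq> 0"
  shows "dproj x v \<in> tangent_space (proj x)"
proof -
  have d: "((\<lambda>y. f (proj y)) has_derivative (\<lambda>v. dproj x v f)) (at x)"
    if "smooth_rproj f" for f :: "'a rproj \<Rightarrow> real"
    using smooth_has_derivative[OF that x] .
  have "dproj x v (\<lambda>p. f p + g p) = dproj x v f + dproj x v g"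
    "dproj x v (\<lambda>p. f p * g p) = f (proj x) * dproj x v g + g (proj x) * dproj x v f"
    if "smooth_rproj f" "smooth_rproj g" for f g
    using dproj_eqI[OF smooth_add[OF that] x has_derivative_add[OF d[OF that(1)] d[OF that(2)]]]
      dproj_eqI[OF smooth_mult[OF that] x has_derivative_mult[OF d[OF that(1)] d[OF that(2)]]]
    by (simp_all add: mult.commute)
  moreover have "dproj x v (\<lambda>p. c * f p) = c * dproj x v f" if "smooth_rproj f" for c f
    using dproj_eqI[OF smooth_scale[OF that] x has_derivative_mult_right[OF d[OF that]]] .
  ultimately show ?thesis
    unfolding tangent_space_def using dproj_not_smooth by auto
qed

text \<open>Pulled back, the field differentiates along \<open>?w\<close>, whose components are
  rational with denominator |x|^2, nonzero off the origin. Smoothness of the result lets fields be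
  applied repeatedly, as in brackets.\<close>

lemma smooth_proj_vfield:
  assumes "smooth_rproj f"
  shows "smooth_rproj (\<lambda>p. proj_vfield M p f)"
proof -
  let ?S = "UNIV - {0 :: real^'a}"
  let ?w = "\<lambda>x. M *v x - ((x \<bullet> (M *v x)) / (norm x)\<^sup>2) *\<^sub>R x"
  note lin = Cinf_on_bounded_linear[OF open_punctured]
  have id: "Cinf_on ?S (\<lambda>x. x \<bullet> b)" and M: "Cinf_on ?S (\<lambda>x. (M *v x) \<bullet> b)" for b
    by (auto intro!: lin bounded_linear_inner_left bounded_linear_inner_left_comp)
  have "Cinf_on ?S (\<lambda>x. x \<bullet> (M *v x))" "Cinf_on ?S (\<lambda>x. x \<bullet> x)"
    by (rule Cinf_on_inner[OF open_punctured id M] Cinf_on_inner[OF open_punctured id id])+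
  then have "Cinf_on ?S (\<lambda>x. (x \<bullet> (M *v x)) / (x \<bullet> x))"
    by (rule Cinf_on_divide[OF open_punctured]) simp
  from Cinf_on_diff[OF open_punctured M Cinf_on_mult[OF open_punctured this id]]
  have "Cinf_on ?S (\<lambda>x. ?w x \<bullet> b)" for b
    by (simp add: inner_diff_left power2_norm_eq_inner)
  then have "Cinf_on ?S (\<lambda>x. frechet_derivative (f \<circ> proj) (at x) (?w x))"
    using assms by (intro Cinf_on_directional open_punctured) (auto simp: smooth_rproj_def)
  then have "Cinf_on ?S (\<lambda>x. proj_vfield M (proj x) f)"
    by (rule Cinf_on_cong[OF open_punctured]) (simp add: proj_vfield_proj dproj_def assms)
  then show ?thesis by (simp add: smooth_rproj_def o_def)
qed

text \<open>The quotient \<open>?g\<close> is homogeneous of degree 0, so it descends to projective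
  space whichever representative is chosen. At \<open>x\<close> the factor
  \<open>u \<bullet> y\<close> vanishes, so only its derivative survives, with coefficient
  (x.x)/(x.x) = 1. The function thus reads off the \<open>u\<close>-component of a tangent
  vector.\<close>

lemma exists_test_function:
  fixes x u :: "real^'d"
  assumes x: "x \<noteq> 0" and u: "u \<bullet> x = 0"
  obtains f where "smooth_rproj f" "\<And>y. y \<noteq> 0 \<Longrightarrow> u \<bullet> y = 0 \<Longrightarrow> f (proj y) = 0"
    "\<And>w. dproj x w f = u \<bullet> w"
proof -
  let ?g = "\<lambda>y. (u \<bullet> y) * (x \<bullet> y) / (y \<bullet> y)"
  define f where "f p = ?g (SOME y. y \<noteq> 0 \<and> proj y = p)" for p
  have f: "f (proj y) = ?g y" if y: "y \<noteq> 0" for y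
  proof -
    define z where "z = (SOME z. z \<noteq> 0 \<and> proj z = proj y)"
    have z: "z \<noteq> 0 \<and> proj z = proj y"
      unfolding z_def by (rule someI[of _ y]) (use y in simp)
    then obtain c where "c \<noteq> 0" "z = c *\<^sub>R y"
      using y proj_eq_iff[of y z] by auto
    then show ?thesis unfolding f_def z_def[symmetric] using y by (simp add: field_simps)
  qed
  have "Cinf_on (UNIV - {0}) ?g"
    using Cinf_on_bounded_linear[OF open_punctured bounded_linear_inner_right]
      Cinf_on_inner[OF open_punctured, of "\<lambda>y. y" "\<lambda>y. y"]
      Cinf_on_bounded_linear[OF open_punctured bounded_linear_inner_left]
    by (intro Cinf_on_divide[OF open_punctured] Cinf_on_mult[OF open_punctured]) auto
  then have sm: "smooth_rproj f"
    unfolding smooth_rproj_def by (rule Cinf_on_cong[OF open_punctured]) (simp add: f)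
  have "(?g has_derivative (\<lambda>w. u \<bullet> w)) (at x)"
    using x u by (auto intro!: derivative_eq_intros simp: field_simps)
  then have "((\<lambda>y. f (proj y)) has_derivative (\<lambda>w. u \<bullet> w)) (at x)"
    by (rule has_derivative_transform_within_open[OF _ open_punctured]) (use x f in auto)
  then show ?thesis
    using that[of f] sm f dproj_eqI[OF sm x] by auto
qed

section \<open>Invariant subspaces and projective linear vector fields\<close>

text \<open>The line through \<open>x\<close> in direction \<open>w\<close> stays in
  \<open>V\<close>, so the pullback of \<open>f\<close> is zero along it near
  \<open>x\<close>.\<close>

lemma dproj_vanish:
  assumes f: "smooth_rproj f" "\<And>y. y \<in> V \<Longrightarrow> y \<noteq> 0 \<Longrightarrow> f (proj y) = 0"
    and V: "subspace V" "x \<in> V" "x \<noteq> 0" "w \<in> V"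
  shows "dproj x w f = 0"
proof -
  have d: "((\<lambda>t::real. x + t *\<^sub>R w) has_derivative (\<lambda>t. t *\<^sub>R w)) (at 0)"
    by (auto intro!: derivative_eq_intros)
  have "((\<lambda>t::real. f (proj (x + t *\<^sub>R w))) has_derivative (\<lambda>t. dproj x (t *\<^sub>R w) f)) (at 0)"
    using has_derivative_compose[OF d, of "\<lambda>y. f (proj y)"]
      smooth_has_derivative[OF f(1) V(3)] by simp
  moreover have "((\<lambda>t::real. f (proj (x + t *\<^sub>R w))) has_derivative (\<lambda>t. 0)) (at 0)"
  proof (rule has_derivative_transform_within_open)
    show "((\<lambda>t::real. 0::real) has_derivative (\<lambda>t. 0)) (at 0)" by simp
    \<comment> \<open>These are the parameters at which the line avoids the origin, where
      \<open>proj\<close> is meaningless.\<close>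
    show "open ((\<lambda>t::real. x + t *\<^sub>R w) -` (UNIV - {0}))"
      by (intro open_vimage open_punctured continuous_intros)
    fix t :: real assume "t \<in> (\<lambda>t::real. x + t *\<^sub>R w) -` (UNIV - {0})"
    moreover have "x + t *\<^sub>R w \<in> V" using V by (intro subspace_add subspace_scale)
    ultimately show "0 = f (proj (x + t *\<^sub>R w))" using f(2) by auto
  qed (use V in auto)
  ultimately have "(\<lambda>t::real. dproj x (t *\<^sub>R w) f) = (\<lambda>t. 0)"
    by (rule has_derivative_unique)
  from fun_cong[OF this, of 1] show ?thesis by simp
qed

text \<open>Derivations that preserve an ideal form a Lie algebra; applied to the ideal of functions
  vanishing on the projectivisation of \<open>V\<close>, this avoids computing brackets.\<close>

definition vanishing_ideal :: "(real^'d) set \<Rightarrow> ('d::finite rproj \<Rightarrow> real) set" where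
  "vanishing_ideal V = {f. smooth_rproj f \<and> (\<forall>y\<in>V. y \<noteq> 0 \<longrightarrow> f (proj y) = 0)}"

text \<open>At a point \<open>y\<close> of \<open>V\<close> the vector representing the field
  combines \<open>M *v y\<close> and \<open>y\<close>, so it lies in \<open>V\<close> and
  \<open>dproj_vanish\<close> applies.\<close>

lemma proj_vfield_preserves_ideal:
  assumes V: "subspace V" "\<And>x. x \<in> V \<Longrightarrow> M *v x \<in> V" and f: "f \<in> vanishing_ideal V"
  shows "(\<lambda>p. proj_vfield M p f) \<in> vanishing_ideal V"
proof -
  have "proj_vfield M (proj y) f = 0" if y: "y \<in> V" "y \<noteq> 0" for y
    unfolding proj_vfield_proj[OF y(2)]
    using f y V by (intro dproj_vanish[of f V] subspace_diff subspace_scale)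
      (auto simp: vanishing_ideal_def)
  then show ?thesis
    using f smooth_proj_vfield by (auto simp: vanishing_ideal_def)
qed

lemma lie_algebra_preserves_ideal:
  assumes V: "subspace V" "\<And>M x. M \<in> \<M> \<Longrightarrow> x \<in> V \<Longrightarrow> M *v x \<in> V"
    and X: "X \<in> generated_lie_algebra (proj_vfield ` \<M>)" and f: "f \<in> vanishing_ideal V"
  shows "(\<lambda>p. X p f) \<in> vanishing_ideal V"
  using X f
proof (induction arbitrary: f)
  case (gen X)
  then show ?case using proj_vfield_preserves_ideal V by blast
next
  case zero
  then show ?case by (simp add: vanishing_ideal_def smooth_const)
next
  case (add X Y)
  then show ?case using smooth_add by (fastforce simp: vanishing_ideal_def)
next
  case (scale X c)
  then show ?case using smooth_scale by (fastforce simp: vanishing_ideal_def)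
next
  case (bracket X Y)
  \<comment> \<open>Each induction hypothesis is applied to the function produced by the other
    field, hence the generalisation over \<open>f\<close>.\<close>
  have "(\<lambda>p. X p (\<lambda>p. Y p f)) \<in> vanishing_ideal V" "(\<lambda>p. Y p (\<lambda>p. X p f)) \<in> vanishing_ideal V"
    using bracket by auto
  then show ?case
    using smooth_diff by (fastforce simp: vanishing_ideal_def bracket_def)
qed

text \<open>Take \<open>x\<close> in \<open>V\<close> and a normal \<open>u\<close> to
  \<open>V\<close>. The test function for \<open>u\<close> vanishes on \<open>V\<close>, so every
  field of the algebra kills it at \<open>proj x\<close>, while \<open>dproj x u\<close> sends it to
  |u|^2. Since \<open>V\<close> contains the image of \<open>B\<close>, it is invariant under
  \<open>B ** K\<close> whatever \<open>K\<close> is.\<close>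

lemma PLARC_invariant_subspace_trivial:
  fixes A :: "real^'d^'d" and B :: "real^'m^'d"
  assumes K: "K \<in> PLARC A B"
    and V: "subspace V" "\<And>x. x \<in> V \<Longrightarrow> A *v x \<in> V" "\<And>x. B *v x \<in> V"
  shows "V = {0} \<or> V = UNIV"
proof (rule ccontr)
  assume "\<not> ?thesis"
  then obtain x where x: "x \<in> V" "x \<noteq> 0" and "V \<noteq> UNIV"
    using subspace_0[OF V(1)] by auto
  then have "span V \<subset> UNIV"
    using V(1) span_eq_iff by blast
  then obtain u where u: "u \<noteq> 0" "\<And>y. y \<in> V \<Longrightarrow> u \<bullet> y = 0"
    using orthogonal_to_subspace_exists_gen[of V UNIV]
    by (metis orthogonal_def span_UNIV span_base)
  obtain f where f: "smooth_rproj f" "\<And>y. y \<noteq> 0 \<Longrightarrow> u \<bullet> y = 0 \<Longrightarrow> f (proj y) = 0"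
    "\<And>w. dproj x w f = u \<bullet> w"
    using exists_test_function[OF x(2) u(2)[OF x(1)]] by metis
  have fV: "f \<in> vanishing_ideal V"
    using f u(2) by (auto simp: vanishing_ideal_def)
  have "dproj x u \<in> {X (proj x) | X. X \<in> generated_lie_algebra {proj_vfield A, proj_vfield (B ** K)}}"
    using K dproj_in_tangent_space[OF x(2), of u] unfolding PLARC_def by blast
  then obtain X where X: "X \<in> generated_lie_algebra (proj_vfield ` {A, B ** K})"
    "X (proj x) = dproj x u" by auto
  have "(\<lambda>p. X p f) \<in> vanishing_ideal V"
    by (rule lie_algebra_preserves_ideal[OF V(1) _ X(1) fV])
      (auto simp: V matrix_vector_mul_assoc[symmetric])
  then have "dproj x u f = 0"
    using X(2) x by (auto simp: vanishing_ideal_def)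
  with f(3) u(1) show False by simp
qed

section \<open>Kalman filtration of a non-controllable pair\<close>

text \<open>With \<open>W k\<close> spanned by the columns of the first \<open>k\<close> Kalman
  blocks, \<open>A\<close> maps \<open>W k\<close> into \<open>W (Suc k)\<close>. Any
  \<open>k\<close> at which the chain pauses therefore gives an invariant subspace.\<close>

lemma noncontrollable_invariant_subspace:
  fixes A :: "real^'d^'d" and B :: "real^'m^'d"
  assumes "\<not> controllable A B"
  obtains V where "subspace V" "\<And>x. x \<in> V \<Longrightarrow> A *v x \<in> V" "\<And>x. B *v x \<in> V" "V \<noteq> UNIV"
proof -
  define P where "P i = ((\<lambda>M. A ** M) ^^ i) B" for i
  define W where "W k = span (\<Union>i<k. columns (P i))" for k :: nat
  have W_mono: "W k \<subseteq> W l" if "k \<le> l" for k l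
    unfolding W_def using that by (intro span_mono) force
  have AW: "A *v x \<in> W (Suc k)" if "x \<in> W k" for x k
  proof -
    have "A *v y \<in> W (Suc k)" if y: "y \<in> (\<Union>i<k. columns (P i))" for y
    proof -
      obtain i j where ij: "i < k" "y = column j (P i)"
        using y by (auto simp: columns_def)
      have "A *v y = column j (P (Suc i))"
        by (simp add: ij P_def vec_eq_iff column_def matrix_matrix_mult_def matrix_vector_mult_def)
      then have "A *v y \<in> columns (P (Suc i))" by (auto simp: columns_def)
      then show ?thesis unfolding W_def using ij(1) by (intro span_base) auto
    qed
    then have "(\<Union>i<k. columns (P i)) \<subseteq> {x. A *v x \<in> W (Suc k)}" by blast
    moreover have "subspace {x. A *v x \<in> W (Suc k)}"
      by (simp add: subspace_def W_def matrix_vector_right_distrib matrix_vector_mult_scaleR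
          span_0 span_add span_scale)
    ultimately have "W k \<subseteq> {x. A *v x \<in> W (Suc k)}"
      unfolding W_def[of k] by (rule span_minimal)
    then show ?thesis using that by blast
  qed
  have "\<exists>k<CARD('d). W (Suc k) = W k"
  proof (rule ccontr)
    assume neq: "\<not> ?thesis"
    \<comment> \<open>Without a pause each of the first d inclusions raises the dimension, so the
      Kalman matrix would have full rank.\<close>
    have "k \<le> CARD('d) \<Longrightarrow> k \<le> dim (W k)" for k
    proof (induction k)
      case (Suc k)
      then have "W (Suc k) \<noteq> W k" using neq by (meson Suc_le_lessD)
      then have "W k \<subset> W (Suc k)" using W_mono[of k "Suc k"] by auto
      then have "dim (W k) < dim (W (Suc k))"
        unfolding W_def using dim_psubset by (metis span_span)
      then show ?case using Suc by simp
    qed simp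
    then have "CARD('d) \<le> dim (W CARD('d))" by simp
    then have "dim (W CARD('d)) = CARD('d)"
      using dim_subset_UNIV_cart[of "W CARD('d)"] by simp
    then show False
      using assms by (simp add: controllable_def W_def P_def)
  qed
  then obtain k where k: "k < CARD('d)" "W (Suc k) = W k" by blast
  show ?thesis
  proof (rule that[of "W k"])
    show "subspace (W k)" by (simp add: W_def)
    show "A *v x \<in> W k" if "x \<in> W k" for x using AW[OF that] k by simp
    \<comment> \<open>The pause may occur at \<open>k = 0\<close>, where \<open>W k\<close> is
      spanned by no block at all; the columns of \<open>B\<close> are therefore placed in
      \<open>W (Suc k)\<close>, which equals \<open>W k\<close>.\<close>
    have "columns B \<subseteq> W (Suc k)"
      unfolding W_def P_def by (rule subset_trans[OF _ span_superset]) force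
    then have "span (columns B) \<subseteq> W k"
      using k(2) by (metis W_def span_minimal subspace_span)
    then show "B *v x \<in> W k" for x
      by (metis matrix_vector_mult_in_columnspace subsetD)
    show "W k \<noteq> UNIV"
    proof
      assume "W k = UNIV"
      then have "W CARD('d) = UNIV" using W_mono[of k "CARD('d)"] k by auto
      then have "dim (W CARD('d)) = CARD('d)" by (simp add: dim_UNIV)
      then show False using assms by (simp add: controllable_def W_def P_def)
    qed
  qed
qed

section \<open>Uncontrolled systems\<close>

lemma proj_vfield_0: "proj_vfield 0 q f = 0"
proof -
  obtain x where x: "x \<noteq> 0" "proj x = q" using proj_surj by blast
  have "dproj x 0 f = 0"
    using has_derivative_linear[OF smooth_has_derivative[of f x]] x dproj_not_smooth[of f x 0]
    by (metis linear_0)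
  then show ?thesis using proj_vfield_proj[OF x(1), of 0] x by simp
qed

lemma proj_vfield_scale:
  assumes "smooth_rproj f"
  shows "proj_vfield A q (\<lambda>p. c * f p) = c * proj_vfield A q f"
proof -
  obtain x where x: "x \<noteq> 0" "proj x = q" using proj_surj by blast
  show ?thesis
    using proj_vfield_proj[OF x(1), of A] dproj_in_tangent_space[OF x(1)] assms x
    by (auto simp: tangent_space_def)
qed

text \<open>The other generator is zero, and constant multiples of a single field commute, so
  brackets add nothing.\<close>

lemma lie_algebra_single:
  assumes "X \<in> generated_lie_algebra {proj_vfield A, proj_vfield 0}"
  shows "\<exists>c. \<forall>q f. smooth_rproj f \<longrightarrow> X q f = c * proj_vfield A q f"
  using assms
proof induction
  case (gen X)
  then show ?case by (auto simp: proj_vfield_0 intro: exI[of _ 1] exI[of _ 0])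
next
  case zero
  then show ?case by (auto intro: exI[of _ 0])
next
  case (add X Y)
  then show ?case by (metis distrib_right)
next
  case (scale X c)
  then show ?case by (metis mult.assoc)
next
  case (bracket X Y)
  then obtain a b where X: "\<And>q f. smooth_rproj f \<Longrightarrow> X q f = a * proj_vfield A q f"
    and Y: "\<And>q f. smooth_rproj f \<Longrightarrow> Y q f = b * proj_vfield A q f" by blast
  \<comment> \<open>Both orders give \<open>a * b\<close> times the second iterate of
    \<open>proj_vfield A\<close>; the inner constant comes out because the inner function is again
    smooth.\<close>
  have "bracket X Y q f = 0" if "smooth_rproj f" for q f
    using that by (simp add: bracket_def X Y smooth_scale smooth_proj_vfield proj_vfield_scale)
  then show ?case by (intro exI[of _ 0]) simp
qed

text \<open>In dimension at least 3 there are nonzero orthogonal \<open>u\<close>, \<open>v\<close>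
  in the complement of \<open>x\<close>. Both \<open>dproj x u\<close> and \<open>dproj x v\<close>
  would be multiples of one vector \<open>D\<close>, but their test functions separate them.\<close>

lemma PLARC_uncontrolled_dim:
  fixes A :: "real^'d^'d" and B :: "real^'m^'d"
  assumes K: "K \<in> PLARC A B" and B: "B = 0"
  shows "CARD('d) \<le> 2"
proof (rule ccontr)
  assume "\<not> ?thesis"
  then have d: "CARD('d) \<ge> 3" by simp
  obtain x :: "real^'d" where x: "x \<noteq> 0"
    using proj_surj by blast
  have "dim {x} < DIM(real^'d)"
    using d dim_le_card'[of "{x}"] by simp
  from orthogonal_to_subspace_exists[OF this] obtain u where u: "u \<noteq> 0" "u \<bullet> x = 0"
    by (metis orthogonal_def singletonI span_base)
  have "dim {x, u} < DIM(real^'d)"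
    using d dim_le_card'[of "{x, u}"] card_insert_le_m1[of 2 "{u}" x] by simp
  from orthogonal_to_subspace_exists[OF this] obtain v where v: "v \<noteq> 0" "v \<bullet> x = 0" "v \<bullet> u = 0"
    by (metis insertCI orthogonal_def span_base)
  obtain f where f: "smooth_rproj f" "\<And>w. dproj x w f = u \<bullet> w"
    using exists_test_function[OF x u(2)] by metis
  obtain g where g: "smooth_rproj g" "\<And>w. dproj x w g = v \<bullet> w"
    using exists_test_function[OF x v(2)] by metis
  define D where "D = proj_vfield A (proj x)"
  have "\<exists>c. \<forall>h. smooth_rproj h \<longrightarrow> dproj x w h = c * D h" for w
  proof -
    have "dproj x w \<in> {X (proj x) | X. X \<in> generated_lie_algebra {proj_vfield A, proj_vfield (B ** K)}}"
      using K dproj_in_tangent_space[OF x, of w] unfolding PLARC_def by blast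
    then obtain X where "X \<in> generated_lie_algebra {proj_vfield A, proj_vfield 0}"
      "dproj x w = X (proj x)" using B by auto
    then show ?thesis using lie_algebra_single unfolding D_def by metis
  qed
  then obtain a b where a: "\<And>h. smooth_rproj h \<Longrightarrow> dproj x u h = a * D h"
    and b: "\<And>h. smooth_rproj h \<Longrightarrow> dproj x v h = b * D h" by metis
  \<comment> \<open>The third equation makes \<open>D g\<close> nonzero, the second then gives
    \<open>a = 0\<close>, and the first fails.\<close>
  have "a * D f = u \<bullet> u" "a * D g = 0" "b * D g = v \<bullet> v"
    using a[OF f(1)] a[OF g(1)] b[OF g(1)] f(2) g(2) v(3) by simp_all
  with u(1) v(1) show False by auto
qed

section \<open>Real eigenlines and the conclusion\<close>

text \<open>As \<open>A\<close> and the eigenvalue are real, the real and imaginary parts of a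
  complex eigenvector satisfy the eigenvector equation separately, and one of them is
  nonzero.\<close>

lemma real_eigenvector:
  fixes A :: "real^'d^'d"
  assumes "complex_eigenvalue A z" "z \<in> \<real>"
  obtains x and r :: real where "x \<noteq> 0" "A *v x = r *\<^sub>R x"
proof -
  obtain v where v: "v \<noteq> 0" "map_matrix complex_of_real A *v v = z *s v"
    using assms(1) by (auto simp: complex_eigenvalue_def)
  obtain r where r: "z = of_real r" using assms(2) by (auto elim: Reals_cases)
  have eq: "(\<Sum>j\<in>UNIV. complex_of_real (A $ i $ j) * v $ j) = of_real r * v $ i" for i
    using v(2) r by (auto simp: vec_eq_iff matrix_vector_mult_def map_matrix_def)
  have "A *v (\<chi> i. Re (v $ i)) = r *\<^sub>R (\<chi> i. Re (v $ i))"
    "A *v (\<chi> i. Im (v $ i)) = r *\<^sub>R (\<chi> i. Im (v $ i))"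
    using arg_cong[OF eq, of Re] arg_cong[OF eq, of Im]
    by (simp_all add: vec_eq_iff matrix_vector_mult_def)
  moreover have "(\<chi> i. Re (v $ i)) \<noteq> 0 \<or> (\<chi> i. Im (v $ i)) \<noteq> 0"
    using v(1) by (auto simp: vec_eq_iff complex_eq_iff)
  ultimately show ?thesis using that by blast
qed

theorem proposition5p3:
  fixes A :: "real^'d^'d" and B :: "real^'m^'d"
  assumes "CARD('d) \<ge> 2"
    and "\<not> controllable A B"
    and "PLARC A B \<noteq> {}"
  shows "B = 0 \<and> CARD('d) = 2 \<and> (\<forall>z. complex_eigenvalue A z \<longrightarrow> z \<notin> \<real>)"
proof -
  obtain K where K: "K \<in> PLARC A B" using assms(3) by blast
  obtain V where V: "subspace V" "\<And>x. x \<in> V \<Longrightarrow> A *v x \<in> V" "\<And>x. B *v x \<in> V" "V \<noteq> UNIV"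
    using noncontrollable_invariant_subspace[OF assms(2)] by blast
  have "V = {0}"
    using PLARC_invariant_subspace_trivial[OF K V(1-3)] V(4) by blast
  then have "\<And>x. B *v x = 0" using V(3) by blast
  then have B: "B = 0" by (simp add: matrix_eq)
  moreover have "CARD('d) = 2"
    using PLARC_uncontrolled_dim[OF K B] assms(1) by simp
  moreover have "z \<notin> \<real>" if z: "complex_eigenvalue A z" for z
  proof
    assume "z \<in> \<real>"
    with z obtain x r where x: "x \<noteq> 0" "A *v x = r *\<^sub>R x"
      using real_eigenvector by blast
    \<comment> \<open>With \<open>B = 0\<close> the eigenline is a candidate invariant subspace; it
      is nonzero, and proper because d is at least 2.\<close>
    have "A *v y \<in> span {x}" if "y \<in> span {x}" for y
      using that x(2) by (auto simp: span_singleton matrix_vector_mult_scaleR)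
    moreover have "B *v y \<in> span {x}" for y by (simp add: B span_0)
    ultimately have "span {x} = {0} \<or> span {x} = UNIV"
      using PLARC_invariant_subspace_trivial[OF K, of "span {x}"] by auto
    moreover have "span {x} \<noteq> {0}" using x(1) span_base[of x "{x}"] by auto
    moreover have "span {x} \<noteq> UNIV"
    proof
      assume "span {x} = UNIV"
      then have "dim {x} = CARD('d)" by (metis dim_span dim_UNIV DIM_cart DIM_real mult.right_neutral)
      then show False using assms(1) dim_le_card'[of "{x}"] by simp
    qed
    ultimately show False by blast
  qed
  ultimately show ?thesis by blast
qed

end
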